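(* Let $n\ge 1$ and $0\le k\le n-1$. There is a bijection between the set of permutations $\pi\in S_n$ with exactly $k$ descents and the set of maxmin trees of weight $0$ on the vertex set $\{1,\dots,n+1\}$ with exactly $k+1$ maxima.
   Context: A descent of $\pi\in S_n$ (written as the word $\pi(1)\cdots\pi(n)$) is an index $i$ with $\pi(i)>\pi(i+1)$. A maxmin tree on $\{1,\dots,N\}$ is a tree $T$ on that vertex set together with a surjective function $t\colon\{1,\dots,N\}\to\{1,2\}$ such that adjacent vertices $v,v'$ have $t(v)\neq t(v')$ and adjacent $v>v'$ have $t(v)>t(v')$; vertices with $t=2$ are maxima and those with $t=1$ minima. The weight $w(T)$ of a tree $T$ with integer vertex labels and such a tiering function $t$ is defined recursively: if $T$ has one vertex, $w(T)=0$. Otherwise let $v$ be the vertex with smallest label and $T_1,\dots,T_l$ the components after deleting $v$ (with restricted labels and tiering); let $u_i\in T_i$ be the neighbor of $v$ in $T_i$ and $w_i$ the number of $u\in T_i$ with $t(u)>t(v)$ and $u<u_i$. Then $w(T)=\sum_{i=1}^l (w_i+w(T_i))$. *)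

theory Defs
  imports "HOL-Combinatorics.Permutations" "HOL-Library.FuncSet"
begin

section \<open>Permutations and descents\<close>

definition descents :: "nat \<Rightarrow> (nat \<Rightarrow> nat) \<Rightarrow> nat set" where
  "descents n p = {i. 1 \<le> i \<and> i < n \<and> p i > p (i + 1)}"

section \<open>Trees\<close>

text \<open>
  A finite simple graph is given by a vertex set \<open>V\<close> and a set \<open>E\<close> of two-element
  subsets of \<open>V\<close>.
\<close>

definition simple_graph :: "'a set \<Rightarrow> 'a set set \<Rightarrow> bool" where
  "simple_graph V E \<longleftrightarrow> finite V \<and> (\<forall>e\<in>E. e \<subseteq> V \<and> card e = 2)"

text \<open>
  The definitions of \<open>reachable\<close> and \<open>components\<close> also make sense when \<open>E\<close> has edges
  leaving \<open>V\<close>; such edges are ignored, so they refer to the subgraph induced on \<open>V\<close>.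
\<close>

definition reachable :: "'a set \<Rightarrow> 'a set set \<Rightarrow> ('a \<times> 'a) set" where
  "reachable V E =
     {(u, v). u \<in> V \<and> v \<in> V \<and> (u, v) \<in> {(x, y). x \<in> V \<and> y \<in> V \<and> {x, y} \<in> E}\<^sup>*}"

definition components :: "'a set \<Rightarrow> 'a set set \<Rightarrow> 'a set set" where
  "components V E = V // reachable V E"

definition connected_graph :: "'a set \<Rightarrow> 'a set set \<Rightarrow> bool" where
  "connected_graph V E \<longleftrightarrow> V \<noteq> {} \<and> (\<forall>u\<in>V. \<forall>v\<in>V. (u, v) \<in> reachable V E)"

definition is_cycle :: "'a set set \<Rightarrow> 'a list \<Rightarrow> bool" where
  "is_cycle E xs \<longleftrightarrow> length xs \<ge> 3 \<and> distinct xs \<and>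
     (\<forall>i<length xs. {xs ! i, xs ! ((i + 1) mod length xs)} \<in> E)"

definition is_tree :: "'a set \<Rightarrow> 'a set set \<Rightarrow> bool" where
  "is_tree V E \<longleftrightarrow> simple_graph V E \<and> connected_graph V E \<and> (\<nexists>xs. is_cycle E xs)"

section \<open>Maxmin trees\<close>

text \<open>
  The vertices with tier 2 are the maxima, those with tier 1 the minima. The tiering function
  is \<open>undefined\<close> outside of \<open>{1..N}\<close>, so that it is determined by its values on the vertices.
\<close>

definition maxmin_tree :: "nat \<Rightarrow> nat set set \<Rightarrow> (nat \<Rightarrow> nat) \<Rightarrow> bool" where
  "maxmin_tree N E t \<longleftrightarrow>
     is_tree {1..N} E \<and>
     t \<in> extensional {1..N} \<and> t ` {1..N} = {1, 2} \<and>
     (\<forall>v v'. {v, v'} \<in> E \<longrightarrow> t v \<noteq> t v') \<and>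
     (\<forall>v v'. {v, v'} \<in> E \<and> v > v' \<longrightarrow> t v > t v')"

definition maxima :: "nat \<Rightarrow> (nat \<Rightarrow> nat) \<Rightarrow> nat set" where
  "maxima N t = {v \<in> {1..N}. t v = 2}"

section \<open>The weight of a tree\<close>

text \<open>In a tree, a component \<open>C\<close> left after deleting \<open>v\<close> contains exactly one neighbor of \<open>v\<close>.\<close>

definition neighbor_in :: "'a set set \<Rightarrow> 'a \<Rightarrow> 'a set \<Rightarrow> 'a" where
  "neighbor_in E v C = (THE u. u \<in> C \<and> {v, u} \<in> E)"

lemma components_subset: "C \<in> components V E \<Longrightarrow> C \<subseteq> V"
  unfolding components_def reachable_def quotient_def by auto

text \<open>
  \<open>weight E t V\<close> is the weight of the tree with vertex set \<open>V\<close> whose edges are those edges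
  of \<open>E\<close> with both ends in \<open>V\<close>; hence \<open>E\<close> and \<open>t\<close> do not change in the recursion. The value is
  irrelevant if \<open>V\<close> is empty or infinite (where \<open>card V = 0\<close>).
\<close>

function weight :: "'a::linorder set set \<Rightarrow> ('a \<Rightarrow> nat) \<Rightarrow> 'a set \<Rightarrow> nat" where
  "weight E t V =
     (if card V \<le> 1 then 0
      else let v = Min V in
        (\<Sum>C\<in>components (V - {v}) E.
           card {u \<in> C. t u > t v \<and> u < neighbor_in E v C} + weight E t C))"
  by pat_completeness auto
termination
proof (relation "measure (\<lambda>(E, t, V). card V)")
  fix E :: "'a set set" and t :: "'a \<Rightarrow> nat" and V v C
  assume card: "\<not> card V \<le> 1" and v: "v = Min V" and C: "C \<in> components (V - {v}) E"
  have fin: "finite V" "V \<noteq> {}"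
    using card card.infinite by fastforce+
  have "C \<subset> V"
    using components_subset[OF C] Min_in[OF fin] v by auto
  then show "((E, t, C), (E, t, V)) \<in> measure (\<lambda>(E, t, V). card V)"
    using psubset_card_mono[OF fin(1)] by simp
qed simp

declare weight.simps [simp del]

end

theory Submission
  imports Defs
begin

text \<open>
  Weight 0 means that the smallest vertex \<open>v\<close> is joined to every component of the rest by the
  smallest maximum of that component. Cutting off the component \<open>C\<close> of the second smallest
  vertex \<open>w\<close> therefore loses no information: a tree of weight 0 on \<open>V\<close> amounts to a set
  \<open>C \<subseteq> V - {v}\<close> containing \<open>w\<close>, a tree of weight 0 on \<open>C\<close> and one on \<open>V - C\<close>. In the same
  way, an arrangement of \<open>V\<close> as a word beginning with \<open>v\<close> is cut in front of \<open>w\<close>. If the vertex of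
  a one-vertex tree counts as a maximum, then both recursions agree and match maxima with the
  positions that are last or a descent: when \<open>V - C = {v}\<close>, the vertex \<open>v\<close> stops being a maximum,
  and otherwise the letter \<open>w\<close> creates a descent in front of it.
\<close>

section \<open>Graphs\<close>

text \<open>The step relation hidden in \<open>reachable\<close>, named so that paths can be
  compared across vertex and edge sets. It ignores edges that leave \<open>V\<close>, so induced
  subgraphs can keep the full \<open>E\<close>.\<close>

definition adj :: "'a set \<Rightarrow> 'a set set \<Rightarrow> ('a \<times> 'a) set" where
  "adj V E = {(x, y). x \<in> V \<and> y \<in> V \<and> {x, y} \<in> E}"

lemma adj_iff: "(x, y) \<in> adj V E \<longleftrightarrow> x \<in> V \<and> y \<in> V \<and> {x, y} \<in> E"
  by (simp add: adj_def)

lemma reachable_iff: "(u, v) \<in> reachable V E \<longleftrightarrow> u \<in> V \<and> v \<in> V \<and> (u, v) \<in> (adj V E)\<^sup>*"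
  by (simp add: reachable_def adj_def)

lemma adj_mono: "V \<subseteq> W \<Longrightarrow> E \<subseteq> F \<Longrightarrow> adj V E \<subseteq> adj W F"
  by (auto simp: adj_def)

lemma adj_rtrancl_mono:
  "(x, y) \<in> (adj V E)\<^sup>* \<Longrightarrow> V \<subseteq> W \<Longrightarrow> E \<subseteq> F \<Longrightarrow> (x, y) \<in> (adj W F)\<^sup>*"
  using rtrancl_mono[OF adj_mono] by blast

lemma adj_rtrancl_sym: "(x, y) \<in> (adj V E)\<^sup>* \<Longrightarrow> (y, x) \<in> (adj V E)\<^sup>*"
  by (rule symD[OF sym_rtrancl]) (auto simp: sym_def adj_def insert_commute)

lemma adj_Pow: "adj V (E \<inter> Pow V) = adj V E"
  by (auto simp: adj_def)

text \<open>A step of \<open>R\<close> may become no step at all of \<open>S\<close>; this is what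
  happens to edges inside a part that is contracted to one vertex.\<close>

lemma rtrancl_map:
  assumes "(x, y) \<in> R\<^sup>*" and "\<And>a b. (a, b) \<in> R \<Longrightarrow> (f a, f b) \<in> S\<^sup>*"
  shows "(f x, f y) \<in> S\<^sup>*"
  using assms(1)
proof induction
  case (step y z)
  then show ?case
    using assms(2) rtrancl_trans by metis
qed simp

lemma equiv_reachable: "equiv V (reachable V E)"
proof (rule equivI)
  show "refl_on V (reachable V E)"
    by (auto simp: refl_on_def reachable_iff)
  show "sym (reachable V E)"
    by (auto simp: sym_def reachable_iff intro: adj_rtrancl_sym)
  show "trans (reachable V E)"
    unfolding trans_def reachable_iff using rtrancl_trans by metis
qed (auto simp: reachable_iff)

lemma connected_graph_iff:
  "connected_graph V E \<longleftrightarrow> V \<noteq> {} \<and> (\<forall>u\<in>V. \<forall>v\<in>V. (u, v) \<in> (adj V E)\<^sup>*)"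
  by (auto simp: connected_graph_def reachable_iff)

lemma connected_graphI:
  assumes "w \<in> V" and "\<And>x. x \<in> V \<Longrightarrow> (w, x) \<in> (adj V E)\<^sup>*"
  shows "connected_graph V E"
  unfolding connected_graph_iff
proof (intro conjI ballI)
  show "V \<noteq> {}"
    using assms(1) by blast
  fix x y assume "x \<in> V" "y \<in> V"
  then show "(x, y) \<in> (adj V E)\<^sup>*"
    using assms(2) adj_rtrancl_sym rtrancl_trans by metis
qed

lemma connected_graph_Pow: "connected_graph V (E \<inter> Pow V) \<longleftrightarrow> connected_graph V E"
  by (simp add: connected_graph_iff adj_Pow)

lemma connected_graph_neighbor:
  assumes "connected_graph V E" "v \<in> V" "V \<noteq> {v}"
  obtains u where "u \<in> V" "{v, u} \<in> E"
proof -
  obtain x where x: "x \<in> V" "x \<noteq> v"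
    using assms(2,3) by blast
  then have "(v, x) \<in> (adj V E)\<^sup>*"
    using assms(1,2) by (auto simp: connected_graph_iff)
  then show thesis
    by (cases rule: converse_rtranclE) (use x(2) that in \<open>auto simp: adj_iff\<close>)
qed

text \<open>A path from a point of a class never leaves the class, so it is a path of the class
  itself; conversely, a connected set that no edge leaves is everything reachable from any of its
  points. Later proofs work with this form instead of the quotient.\<close>

lemma components_iff:
  "C \<in> components U E \<longleftrightarrow>
     C \<subseteq> U \<and> connected_graph C E \<and> (\<forall>x\<in>C. \<forall>y\<in>U - C. {x, y} \<notin> E)"
proof safe
  assume C: "C \<in> components U E"
  then obtain w where w: "w \<in> U" and Ceq: "C = reachable U E `` {w}"
    by (auto simp: components_def elim: quotientE)
  have Ciff: "x \<in> C \<longleftrightarrow> x \<in> U \<and> (w, x) \<in> (adj U E)\<^sup>*" for x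
    using w by (auto simp: Ceq reachable_iff)
  show "x \<in> U" if "x \<in> C" for x
    using that Ciff by blast
  show "connected_graph C E"
  proof (rule connected_graphI)
    show "w \<in> C"
      using w Ciff by blast
    fix x assume "x \<in> C"
    then have "(w, x) \<in> (adj U E)\<^sup>*"
      using Ciff by blast
    then show "(w, x) \<in> (adj C E)\<^sup>*"
    proof induction
      case (step y z)
      then have "(y, z) \<in> adj C E"
        using w by (auto simp: adj_iff Ciff intro: rtrancl_into_rtrancl)
      then show ?case
        using step.IH by simp
    qed simp
  qed
  show False if "x \<in> C" "y \<in> U" "y \<notin> C" "{x, y} \<in> E" for x y
    using that by (auto simp: Ciff adj_iff dest: rtrancl_into_rtrancl)
next
  assume sub: "C \<subseteq> U" and con: "connected_graph C E"
    and closed: "\<forall>x\<in>C. \<forall>y\<in>U - C. {x, y} \<notin> E"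
  obtain w where w: "w \<in> C"
    using con by (auto simp: connected_graph_iff)
  have "C = reachable U E `` {w}"
  proof (intro equalityI subsetI)
    fix x assume "x \<in> C"
    then show "x \<in> reachable U E `` {w}"
      using con w sub by (auto simp: connected_graph_iff reachable_iff intro: adj_rtrancl_mono)
  next
    fix x assume "x \<in> reachable U E `` {w}"
    then have "(w, x) \<in> (adj U E)\<^sup>*"
      by (simp add: reachable_iff)
    then show "x \<in> C"
      by induction (use w closed in \<open>auto simp: adj_iff\<close>)
  qed
  then show "C \<in> components U E"
    using w sub by (auto simp: components_def intro: quotientI)
qed

lemma components_connected: "C \<in> components U E \<Longrightarrow> connected_graph C E"
  and components_closed: "C \<in> components U E \<Longrightarrow> x \<in> C \<Longrightarrow> y \<in> U - C \<Longrightarrow> {x, y} \<notin> E"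
  by (auto simp: components_iff)

lemma components_unique:
  assumes "C \<in> components U E" "D \<in> components U E" "x \<in> C" "x \<in> D"
  shows "C = D"
  using quotient_disj[OF equiv_reachable] assms unfolding components_def by blast

lemma components_cong:
  assumes "\<And>x y. x \<in> U \<Longrightarrow> y \<in> U \<Longrightarrow> {x, y} \<in> E \<longleftrightarrow> {x, y} \<in> F"
  shows "components U E = components U F"
proof -
  have "adj U E = adj U F"
    using assms by (auto simp: adj_def)
  then have "reachable U E = reachable U F"
    by (auto simp: reachable_iff)
  then show ?thesis
    by (simp add: components_def)
qed

text \<open>No edge runs between \<open>C\<close> and the rest of \<open>U\<close>, so the other
  components survive unchanged. This peels one summand off the sum in \<open>weight\<close>.\<close>

lemma components_remove:
  assumes C: "C \<in> components U E"
  shows "components U E = insert C (components (U - C) E)" "C \<notin> components (U - C) E"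
proof -
  have D: "D \<in> components (U - C) E" if "D \<in> components U E" "D \<noteq> C" for D
  proof -
    have "D \<inter> C = {}"
      using components_unique[OF that(1) C] that(2) by blast
    then show ?thesis
      using that(1) by (auto simp: components_iff)
  qed
  have D': "D \<in> components U E" if "D \<in> components (U - C) E" for D
  proof -
    have "{x, y} \<notin> E" if "x \<in> D" "y \<in> C" for x y
      using C that \<open>D \<in> components (U - C) E\<close> insert_commute[of x y "{}"]
      by (auto simp: components_iff subset_iff)
    then show ?thesis
      using that unfolding components_iff by blast
  qed
  show "components U E = insert C (components (U - C) E)"
    using C D D' by blast
  show "C \<notin> components (U - C) E"
    using C by (auto simp: components_iff connected_graph_iff)
qed

lemma components_empty: "components {} E = {}"
  by (simp add: components_def quotient_def)

lemma finite_components: "finite U \<Longrightarrow> finite (components U E)"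
  by (rule finite_subset[of _ "Pow U"]) (auto simp: components_iff)

section \<open>Trees\<close>

text \<open>If the new first vertex already occurs on the path, the path is cut back to start at
  that occurrence.\<close>

lemma rtrancl_distinct_path:
  assumes "(a, b) \<in> R\<^sup>*"
  shows "\<exists>xs. xs \<noteq> [] \<and> hd xs = a \<and> last xs = b \<and> distinct xs \<and>
    successively (\<lambda>x y. (x, y) \<in> R) xs"
  using assms
proof (induction rule: converse_rtrancl_induct)
  case base
  show ?case
    by (rule exI[of _ "[b]"]) simp
next
  case (step a c)
  then obtain xs where xs: "xs \<noteq> []" "hd xs = c" "last xs = b" "distinct xs"
    "successively (\<lambda>x y. (x, y) \<in> R) xs"
    by blast
  show ?case
  proof (cases "a \<in> set xs")
    case False
    then show ?thesis
      using xs step(1) by (intro exI[of _ "a # xs"]) (auto simp: successively_Cons)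
  next
    case True
    then obtain ys zs where "xs = ys @ a # zs"
      by (auto simp: in_set_conv_decomp)
    then show ?thesis
      using xs by (intro exI[of _ "a # zs"]) (auto simp: successively_append_iff)
  qed
qed

text \<open>A cycle through an edge is a path between its ends that avoids the edge, closed up by
  it. The bridge condition is easier to transport than the absence of cyclic lists when graphs are
  joined or restricted.\<close>

lemma no_cycle_iff_bridges:
  assumes "simple_graph V E"
  shows "(\<nexists>xs. is_cycle E xs) \<longleftrightarrow>
    (\<forall>a b. {a, b} \<in> E \<longrightarrow> (a, b) \<notin> (adj V (E - {{a, b}}))\<^sup>*)"
proof
  assume nc: "\<nexists>xs. is_cycle E xs"
  show "\<forall>a b. {a, b} \<in> E \<longrightarrow> (a, b) \<notin> (adj V (E - {{a, b}}))\<^sup>*"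
  proof (intro allI impI notI)
    fix a b assume ab: "{a, b} \<in> E" and "(a, b) \<in> (adj V (E - {{a, b}}))\<^sup>*"
    then obtain xs where xs: "xs \<noteq> []" "hd xs = a" "last xs = b" "distinct xs"
      and suc: "successively (\<lambda>x y. (x, y) \<in> adj V (E - {{a, b}})) xs"
      using rtrancl_distinct_path by metis
    have "a \<noteq> b"
      using assms ab by (auto simp: simple_graph_def)
    have "length xs \<ge> 3"
    proof (rule ccontr)
      assume "\<not> length xs \<ge> 3"
      then consider "length xs = 1" | "length xs = 2"
        using length_greater_0_conv[of xs] xs(1) by linarith
      then show False
      proof cases
        case 1
        then show ?thesis
          using xs \<open>a \<noteq> b\<close> by (cases xs) auto
      next
        case 2
        then obtain p q where "xs = [p, q]"
          by (auto simp: length_Suc_conv numeral_2_eq_2)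
        then show ?thesis
          using xs suc by (simp add: adj_iff)
      qed
    qed
    moreover have "{xs ! i, xs ! ((i + 1) mod length xs)} \<in> E" if i: "i < length xs" for i
    proof (cases "i + 1 < length xs")
      case True
      then show ?thesis
        using suc by (auto simp: successively_conv_nth adj_iff)
    next
      \<comment> \<open>The wrap-around edge leads from \<open>b\<close> back to \<open>a\<close>,
        so it is the deleted edge.\<close>
      case False
      then have "i = length xs - 1"
        using i by simp
      then show ?thesis
        using xs ab i by (auto simp: hd_conv_nth last_conv_nth insert_commute)
    qed
    ultimately show False
      using nc xs(4) by (auto simp: is_cycle_def)
  qed
next
  assume br: "\<forall>a b. {a, b} \<in> E \<longrightarrow> (a, b) \<notin> (adj V (E - {{a, b}}))\<^sup>*"
  show "\<nexists>xs. is_cycle E xs"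
  proof
    assume "\<exists>xs. is_cycle E xs"
    then obtain xs where len: "length xs \<ge> 3" and dist: "distinct xs"
      and cyc: "\<And>i. i < length xs \<Longrightarrow> {xs ! i, xs ! ((i + 1) mod length xs)} \<in> E"
      by (auto simp: is_cycle_def)
    \<comment> \<open>The edge between the last and the first entry closes the cycle; the remaining
      edges form a path around it.\<close>
    define a b where "a = xs ! 0" and "b = xs ! (length xs - 1)"
    have "length xs - 1 + 1 = length xs"
      using len by linarith
    then have "{b, a} \<in> E"
      using cyc[of "length xs - 1"] len unfolding a_def b_def
      by (metis diff_less mod_self length_greater_0_conv list.size(3) not_numeral_le_zero zero_less_one)
    then have ab: "{a, b} \<in> E"
      by (simp only: insert_commute)
    have "(a, xs ! i) \<in> (adj V (E - {{a, b}}))\<^sup>*" if "i < length xs" for i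
      using that
    proof (induction i)
      case (Suc i)
      have e: "{xs ! i, xs ! Suc i} \<in> E"
        using cyc[of i] Suc.prems by simp
      \<comment> \<open>With at least three distinct entries, no other pair of consecutive entries
        equals the closing edge.\<close>
      moreover have "{xs ! i, xs ! Suc i} \<noteq> {a, b}"
        using Suc.prems len nth_eq_iff_index_eq[OF dist, of i 0]
          nth_eq_iff_index_eq[OF dist, of i "length xs - 1"]
          nth_eq_iff_index_eq[OF dist, of "Suc i" 0]
          nth_eq_iff_index_eq[OF dist, of "Suc i" "length xs - 1"]
        unfolding a_def b_def doubleton_eq_iff by linarith
      moreover have "xs ! i \<in> V" "xs ! Suc i \<in> V"
        using e assms by (auto simp: simple_graph_def)
      ultimately have "(xs ! i, xs ! Suc i) \<in> adj V (E - {{a, b}})"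
        by (simp add: adj_iff)
      then show ?case
        using Suc by (meson Suc_lessD rtrancl_into_rtrancl)
    qed (simp add: a_def)
    then have "(a, b) \<in> (adj V (E - {{a, b}}))\<^sup>*"
      using len by (simp add: b_def)
    then show False
      using br ab by blast
  qed
qed

lemma is_tree_iff:
  "is_tree V E \<longleftrightarrow> simple_graph V E \<and> connected_graph V E \<and>
    (\<forall>a b. {a, b} \<in> E \<longrightarrow> (a, b) \<notin> (adj V (E - {{a, b}}))\<^sup>*)"
proof (cases "simple_graph V E")
  case True
  show ?thesis
    unfolding is_tree_def no_cycle_iff_bridges[OF True] ..
qed (simp add: is_tree_def)

lemma is_tree_singleton: "is_tree {v} E \<longleftrightarrow> E = {}"
proof
  assume t: "is_tree {v} E"
  have "e \<subseteq> {v} \<Longrightarrow> card e \<noteq> 2" for e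
    using card_mono[of "{v}" e] by auto
  then show "E = {}"
    using t by (auto simp: is_tree_def simple_graph_def)
qed (auto simp: is_tree_iff simple_graph_def connected_graph_iff)

section \<open>Joining two trees by an edge and cutting a tree at a vertex\<close>

text \<open>
  Contracting one of the two parts to the end of the joining edge in the other part turns a
  path of the big tree into a path of the other part.
\<close>

lemma bridges_join:
  assumes t1: "is_tree V1 E1" and t2: "is_tree V2 E2" and disj: "V1 \<inter> V2 = {}"
    and a: "a \<in> V1" and b: "b \<in> V2" and e: "{x, y} \<in> E1"
  shows "(x, y) \<notin> (adj (V1 \<union> V2) (insert {a, b} (E1 \<union> E2) - {{x, y}}))\<^sup>*"
proof
  define f where "f z = (if z \<in> V1 then z else a)" for z
  assume "(x, y) \<in> (adj (V1 \<union> V2) (insert {a, b} (E1 \<union> E2) - {{x, y}}))\<^sup>*"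
  then have "(f x, f y) \<in> (adj V1 (E1 - {{x, y}}))\<^sup>*"
  proof (rule rtrancl_map)
    fix p q assume pq: "(p, q) \<in> adj (V1 \<union> V2) (insert {a, b} (E1 \<union> E2) - {{x, y}})"
    have s: "\<And>e. e \<in> E1 \<Longrightarrow> e \<subseteq> V1" "\<And>e. e \<in> E2 \<Longrightarrow> e \<subseteq> V2"
      using t1 t2 by (auto simp: is_tree_def simple_graph_def)
    consider "{p, q} = {a, b}" | "{p, q} \<in> E1 - {{x, y}}" | "{p, q} \<in> E2"
      using pq by (auto simp: adj_iff)
    then show "(f p, f q) \<in> (adj V1 (E1 - {{x, y}}))\<^sup>*"
    proof cases
      case 1
      then have "f p = f q"
        using a b disj by (auto simp: f_def doubleton_eq_iff)
      then show ?thesis by simp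
    next
      case 2
      then have "(f p, f q) \<in> adj V1 (E1 - {{x, y}})"
        using s(1)[of "{p, q}"] by (auto simp: f_def adj_iff)
      then show ?thesis by simp
    next
      case 3
      then have "f p = f q"
        using s(2)[of "{p, q}"] disj by (auto simp: f_def)
      then show ?thesis by simp
    qed
  qed
  moreover have "f x = x" "f y = y"
    using e t1 by (auto simp: f_def is_tree_def simple_graph_def)
  ultimately show False
    using t1 e by (auto simp: is_tree_iff)
qed

text \<open>Edges of either part stay bridges by \<open>bridges_join\<close>, used once with the
  parts exchanged. The joining edge is a bridge because no step changes sides without it.\<close>

lemma tree_join:
  assumes t1: "is_tree V1 E1" and t2: "is_tree V2 E2" and disj: "V1 \<inter> V2 = {}"
    and a: "a \<in> V1" and b: "b \<in> V2"
  shows "is_tree (V1 \<union> V2) (insert {a, b} (E1 \<union> E2))" (is "is_tree ?V ?E")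
proof -
  have s1: "simple_graph V1 E1" and s2: "simple_graph V2 E2"
    and c1: "connected_graph V1 E1" and c2: "connected_graph V2 E2"
    using t1 t2 by (auto simp: is_tree_def)
  have "a \<noteq> b"
    using a b disj by blast
  then have simple: "simple_graph ?V ?E"
    using s1 s2 a b by (auto simp: simple_graph_def)
  have "connected_graph ?V ?E"
  proof (rule connected_graphI)
    show "a \<in> ?V"
      using a by simp
    fix x assume "x \<in> ?V"
    then consider "x \<in> V1" | "x \<in> V2"
      by blast
    then show "(a, x) \<in> (adj ?V ?E)\<^sup>*"
    proof cases
      case 1
      then have "(a, x) \<in> (adj V1 E1)\<^sup>*"
        using c1 a by (auto simp: connected_graph_iff)
      then show ?thesis
        by (rule adj_rtrancl_mono) auto
    next
      case 2
      then have "(b, x) \<in> (adj V2 E2)\<^sup>*"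
        using c2 b by (auto simp: connected_graph_iff)
      then have "(b, x) \<in> (adj ?V ?E)\<^sup>*"
        by (rule adj_rtrancl_mono) auto
      moreover have "(a, b) \<in> adj ?V ?E"
        using a b by (simp add: adj_iff)
      ultimately show ?thesis
        by (rule converse_rtrancl_into_rtrancl[rotated])
    qed
  qed
  moreover have "(x, y) \<notin> (adj ?V (?E - {{x, y}}))\<^sup>*" if "{x, y} \<in> ?E" for x y
  proof -
    consider "{x, y} \<in> E1" | "{x, y} \<in> E2" | "{x, y} = {a, b}"
      using \<open>{x, y} \<in> ?E\<close> by blast
    then show ?thesis
    proof cases
      case 1
      then show ?thesis
        using bridges_join[OF t1 t2 disj a b] by simp
    next
      case 2
      then show ?thesis
        using bridges_join[OF t2 t1 _ b a] disj by (simp add: Un_commute insert_commute Int_commute)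
    next
      case 3
      have stay: "q \<in> V1 \<longleftrightarrow> p \<in> V1" if "(p, q) \<in> (adj ?V (?E - {{x, y}}))\<^sup>*" for p q
        using that
      proof induction
        case (step q r)
        then have "{q, r} \<in> E1 \<or> {q, r} \<in> E2"
          using 3 by (auto simp: adj_iff)
        then have "{q, r} \<subseteq> V1 \<or> {q, r} \<subseteq> V2"
          using s1 s2 by (auto simp: simple_graph_def)
        then show ?case
          using step.IH disj by auto
      qed simp
      have "\<not> (x \<in> V1 \<longleftrightarrow> y \<in> V1)"
        using 3 a b disj by (auto simp: doubleton_eq_iff)
      then show ?thesis
        using stay by blast
    qed
  qed
  ultimately show ?thesis
    using simple by (auto simp: is_tree_iff)
qed

text \<open>A path in the smaller graph is a path in the larger one, so bridges stay bridges and
  only connectedness has to be supplied.\<close>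

lemma tree_induced:
  assumes "is_tree V E" "W \<subseteq> V" "connected_graph W E"
  shows "is_tree W (E \<inter> Pow W)"
  unfolding is_tree_iff connected_graph_Pow
proof (intro conjI allI impI)
  show "simple_graph W (E \<inter> Pow W)"
    using assms finite_subset by (auto simp: is_tree_def simple_graph_def)
  show "(a, b) \<notin> (adj W (E \<inter> Pow W - {{a, b}}))\<^sup>*" if "{a, b} \<in> E \<inter> Pow W" for a b
  proof
    assume "(a, b) \<in> (adj W (E \<inter> Pow W - {{a, b}}))\<^sup>*"
    then have "(a, b) \<in> (adj V (E - {{a, b}}))\<^sup>*"
      by (rule adj_rtrancl_mono) (use assms in auto)
    then show False
      using assms(1) that by (auto simp: is_tree_iff)
  qed
qed (fact assms(3))

lemma tree_component:
  assumes "is_tree V E" "C \<in> components (V - {v}) E"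
  shows "is_tree C (E \<inter> Pow C)"
proof (rule tree_induced[OF assms(1)])
  show "C \<subseteq> V"
    using components_subset[OF assms(2)] by blast
qed (rule components_connected[OF assms(2)])

text \<open>Contract \<open>C\<close> to \<open>v\<close>: edges leaving \<open>C\<close> end in
  \<open>v\<close>, so every edge becomes a point or an edge outside \<open>C\<close>, and paths
  from \<open>v\<close> become paths in \<open>V - C\<close>.\<close>

lemma tree_remove_component:
  assumes t: "is_tree V E" and v: "v \<in> V" and C: "C \<in> components (V - {v}) E"
  shows "is_tree (V - C) (E \<inter> Pow (V - C))"
proof (rule tree_induced[OF t])
  have vC: "v \<notin> C"
    using C by (auto simp: components_iff)
  define f where "f x = (if x \<in> C then v else x)" for x
  show "connected_graph (V - C) E"
  proof (rule connected_graphI)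
    show "v \<in> V - C"
      using v vC by simp
    fix x assume x: "x \<in> V - C"
    then have "(v, x) \<in> (adj V E)\<^sup>*"
      using t v by (auto simp: is_tree_def connected_graph_iff)
    then have "(f v, f x) \<in> (adj (V - C) E)\<^sup>*"
    proof (rule rtrancl_map)
      fix p q assume pq: "(p, q) \<in> adj V E"
      then have "{p, q} \<in> E" "{q, p} \<in> E" "p \<in> V" "q \<in> V"
        by (auto simp: adj_iff insert_commute)
      then have "f p = f q \<or> (f p, f q) \<in> adj (V - C) E"
        using components_closed[OF C] by (auto simp: f_def adj_iff)
      then show "(f p, f q) \<in> (adj (V - C) E)\<^sup>*"
        by auto
    qed
    then show "(v, x) \<in> (adj (V - C) E)\<^sup>*"
      using x vC by (simp add: f_def)
  qed
qed blast

text \<open>Connectedness gives an edge from \<open>v\<close> into \<open>C\<close>. A second one,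
  continued by a path inside \<open>C\<close>, would bypass the first, which is a bridge. All other
  edges lie on one side.\<close>

lemma tree_component_edges:
  assumes t: "is_tree V E" and v: "v \<in> V" and C: "C \<in> components (V - {v}) E"
  obtains u where "u \<in> C" "E = insert {v, u} (E \<inter> Pow (V - C) \<union> E \<inter> Pow C)"
proof -
  have CV: "C \<subseteq> V - {v}" and con: "connected_graph C E"
    using C by (auto simp: components_iff)
  obtain w where w: "w \<in> C"
    using con by (auto simp: connected_graph_iff)
  have "\<exists>u\<in>C. {v, u} \<in> E"
  proof (rule ccontr)
    assume none: "\<not> (\<exists>u\<in>C. {v, u} \<in> E)"
    have "(w, v) \<in> (adj V E)\<^sup>*"
      using t v w CV by (auto simp: is_tree_def connected_graph_iff)
    \<comment> \<open>Without an edge between \<open>v\<close> and \<open>C\<close> the path could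
      never leave \<open>C\<close>.\<close>
    then have "v \<in> C"
    proof induction
      case (step y z)
      then show ?case
        using components_closed[OF C, of y z] none by (auto simp: adj_iff insert_commute)
    qed (fact w)
    then show False
      using CV by blast
  qed
  then obtain u where u: "u \<in> C" "{v, u} \<in> E"
    by blast
  have uniq: "x = u" if x: "x \<in> C" "{v, x} \<in> E" for x
  proof (rule ccontr)
    assume "x \<noteq> u"
    have "(x, u) \<in> (adj C E)\<^sup>*"
      using con x u by (auto simp: connected_graph_iff)
    then have "(x, u) \<in> (adj C (E \<inter> Pow C))\<^sup>*"
      by (simp add: adj_Pow)
    then have "(x, u) \<in> (adj V (E - {{v, u}}))\<^sup>*"
      by (rule adj_rtrancl_mono) (use CV in auto)
    moreover have "(v, x) \<in> adj V (E - {{v, u}})"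
      using x u v CV \<open>x \<noteq> u\<close> by (auto simp: adj_iff doubleton_eq_iff)
    ultimately have "(v, u) \<in> (adj V (E - {{v, u}}))\<^sup>*"
      by (rule converse_rtrancl_into_rtrancl[rotated])
    then show False
      using t u by (auto simp: is_tree_iff)
  qed
  have "e \<in> insert {v, u} (E \<inter> Pow (V - C) \<union> E \<inter> Pow C)" if e: "e \<in> E" for e
  proof -
    have "e \<subseteq> V" "card e = 2"
      using t e by (auto simp: is_tree_def simple_graph_def)
    then obtain x y where xy: "e = {x, y}" "x \<in> V" "y \<in> V"
      by (auto simp: card_2_iff)
    then have "{x, y} \<in> E" "{y, x} \<in> E"
      using e by (auto simp: insert_commute)
    then show ?thesis
      using xy components_closed[OF C, of x y] components_closed[OF C, of y x] uniq[of x] uniq[of y] CV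
      by (cases "x = v"; cases "y = v") (auto simp: insert_commute)
  qed
  then show thesis
    using that[of u] u by blast
qed

section \<open>Weights\<close>

lemma neighbor_in_cong:
  "(\<And>u. u \<in> C \<Longrightarrow> {v, u} \<in> E \<longleftrightarrow> {v, u} \<in> F) \<Longrightarrow> neighbor_in E v C = neighbor_in F v C"
  unfolding neighbor_in_def by (rule arg_cong[where f = The]) auto

lemma weight_trivial: "card V \<le> 1 \<Longrightarrow> weight E t V = 0"
  by (subst weight.simps) simp

text \<open>The recursion of \<open>weight\<close> carries the full \<open>E\<close> and
  \<open>t\<close> along, while the trees below are restricted to their own vertices; this passes
  between the two.\<close>

lemma weight_cong:
  assumes "\<And>x y. x \<in> V \<Longrightarrow> y \<in> V \<Longrightarrow> {x, y} \<in> E \<longleftrightarrow> {x, y} \<in> F"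
    and "\<And>x. x \<in> V \<Longrightarrow> t x = s x"
  shows "weight E t V = weight F s V"
  using assms
proof (induction E t V rule: weight.induct)
  case (1 E t V)
  show ?case
  proof (cases "card V \<le> 1")
    case True
    then show ?thesis
      by (simp add: weight_trivial)
  next
    case False
    have "Min V \<in> V"
      using False card.infinite[of V] by (intro Min_in) fastforce+
    have comp: "components (V - {Min V}) F = components (V - {Min V}) E"
      by (rule components_cong) (use "1.prems" in auto)
    have "card {u \<in> C. t u > t (Min V) \<and> u < neighbor_in E (Min V) C} + weight E t C =
      card {u \<in> C. s u > s (Min V) \<and> u < neighbor_in F (Min V) C} + weight F s C"
      if C: "C \<in> components (V - {Min V}) E" for C
    proof -
      have sub: "C \<subseteq> V"
        using components_subset[OF C] by blast
      have "neighbor_in E (Min V) C = neighbor_in F (Min V) C"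
        by (rule neighbor_in_cong) (use "1.prems" sub \<open>Min V \<in> V\<close> in auto)
      moreover have "weight E t C = weight F s C"
        by (rule "1.IH"[OF False refl C]) (use "1.prems" sub in auto)
      moreover have "{u \<in> C. t u > t (Min V) \<and> u < n} = {u \<in> C. s u > s (Min V) \<and> u < n}" for n
        using "1.prems"(2) sub \<open>Min V \<in> V\<close> by auto
      ultimately show ?thesis
        by simp
    qed
    then show ?thesis
      using False by (simp add: weight.simps[of _ _ V] Let_def comp)
  qed
qed

text \<open>Deleting \<open>C\<close> keeps \<open>v\<close> as the minimum and keeps the other
  components, so the sums for \<open>V\<close> and \<open>V - C\<close> differ by the one summand of
  \<open>C\<close>.\<close>

lemma weight_remove_component:
  assumes fin: "finite V" and v: "v = Min V" "v \<in> V" and C: "C \<in> components (V - {v}) E"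
  shows "weight E t V =
    card {u \<in> C. t u > t v \<and> u < neighbor_in E v C} + weight E t C + weight E t (V - C)"
proof -
  have CV: "C \<subseteq> V - {v}" "C \<noteq> {}"
    using C by (auto simp: components_iff connected_graph_iff)
  then obtain w where w: "w \<in> C" "w \<in> V" "w \<noteq> v"
    by blast
  have "card {v, w} \<le> card V"
    by (rule card_mono) (use fin v w in auto)
  then have card: "\<not> card V \<le> 1"
    using w by simp
  define g where
    "g C = card {u \<in> C. t u > t v \<and> u < neighbor_in E v C} + weight E t C" for C
  have "Min (V - C) = v"
    by (rule Min_eqI) (use fin v CV in auto)
  have rest: "weight E t (V - C) = sum g (components (V - {v} - C) E)"
  proof (cases "card (V - C) \<le> 1")
    \<comment> \<open>Here \<open>V - C\<close> is \<open>{v}\<close>, where \<open>weight\<close>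
      has its base value 0; the sum agrees because no component is left.\<close>
    case True
    then have "x = y" if "x \<in> V - C" "y \<in> V - C" for x y
      using True that fin card_le_Suc0_iff_eq[of "V - C"] by simp
    moreover have "v \<in> V - C"
      using v(2) CV(1) by blast
    ultimately have "V - C = {v}"
      by blast
    then have "V - {v} - C = {}"
      by blast
    then have "components (V - {v} - C) E = {}"
      by (simp only: components_empty)
    then show ?thesis
      using True by (simp add: weight_trivial)
  next
    case False
    moreover have "V - C - {v} = V - {v} - C"
      by blast
    ultimately show ?thesis
      using \<open>Min (V - C) = v\<close> by (simp add: weight.simps[of _ _ "V - C"] g_def Let_def)
  qed
  have "weight E t V = sum g (components (V - {v}) E)"
    using card by (simp add: weight.simps[of _ _ V] g_def Let_def v(1)[symmetric])
  also have "\<dots> = g C + sum g (components (V - {v} - C) E)"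
    using components_remove[OF C] fin by (simp add: finite_components)
  finally show ?thesis
    using rest by (simp add: g_def)
qed

definition tier :: "'a set \<Rightarrow> 'a \<Rightarrow> nat" where
  "tier M x = (if x \<in> M then 2 else 1)"

text \<open>
  A maxmin tree is encoded by its edges \<open>E\<close> and its set \<open>M\<close> of maxima. The condition
  \<open>M \<noteq> {}\<close> makes the vertex of a one-vertex tree a maximum.
\<close>

definition zero_trees :: "'a::linorder set \<Rightarrow> ('a set set \<times> 'a set) set" where
  "zero_trees V = {(E, M). is_tree V E \<and> M \<subseteq> V \<and> M \<noteq> {} \<and>
     (\<forall>a b. {a, b} \<in> E \<and> a < b \<longrightarrow> a \<notin> M \<and> b \<in> M) \<and> weight E (tier M) V = 0}"

lemma zero_trees_singleton: "zero_trees {v} = {({}, {v})}"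
  by (auto simp: zero_trees_def is_tree_singleton weight_trivial)

lemma is_tree_edge_neq: "is_tree V E \<Longrightarrow> {x, y} \<in> E \<Longrightarrow> x \<noteq> y"
  by (auto simp: is_tree_def simple_graph_def)

lemma is_tree_edge_subset: "is_tree V E \<Longrightarrow> e \<in> E \<Longrightarrow> e \<subseteq> V"
  by (auto simp: is_tree_def simple_graph_def)

lemma Min_neighbor_max:
  assumes T: "(E, M) \<in> zero_trees V" and fin: "finite V" and v: "v = Min V"
    and e: "{v, u} \<in> E"
  shows "v < u" "v \<notin> M" "u \<in> M"
proof -
  have t: "is_tree V E"
    using T by (simp add: zero_trees_def)
  show "v < u"
    using is_tree_edge_neq[OF t e] is_tree_edge_subset[OF t e] fin v
    by (metis Min_le insert_subset order_le_neq_trans)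
  then show "v \<notin> M" "u \<in> M"
    using T e by (auto simp: zero_trees_def)
qed

text \<open>In a larger tree \<open>v\<close> has a neighbor above it. The hypothesis
  \<open>V \<noteq> {v}\<close> keeps away the convention that a lone vertex is a maximum.\<close>

lemma Min_not_max:
  assumes T: "(E, M) \<in> zero_trees V" and fin: "finite V" and v: "v = Min V" "v \<in> V" "V \<noteq> {v}"
  shows "v \<notin> M"
proof -
  have "connected_graph V E"
    using T by (simp add: zero_trees_def is_tree_def)
  then obtain u where "{v, u} \<in> E"
    using connected_graph_neighbor v by metis
  then show ?thesis
    using Min_neighbor_max[OF T fin v(1)] by blast
qed

text \<open>The three summands of \<open>weight_remove_component\<close> must vanish separately. As
  \<open>v\<close> has tier 1, the first one counts the maxima of \<open>C\<close> below
  \<open>u\<close>, and \<open>u\<close> is itself a maximum.\<close>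

lemma weight_tier_eq_0_iff:
  assumes fin: "finite V" and v: "v = Min V" "v \<in> V" and C: "C \<in> components (V - {v}) E"
    and u: "u \<in> C" "\<And>x. x \<in> C \<Longrightarrow> {v, x} \<in> E \<longleftrightarrow> x = u" and M: "v \<notin> M" "u \<in> M"
  shows "weight E (tier M) V = 0 \<longleftrightarrow>
    u = Min (M \<inter> C) \<and> weight E (tier M) C = 0 \<and> weight E (tier M) (V - C) = 0"
proof -
  have "neighbor_in E v C = u"
    unfolding neighbor_in_def using u by (intro the_equality) auto
  then have W: "weight E (tier M) V = card {x \<in> C. tier M x > tier M v \<and> x < u} +
      weight E (tier M) C + weight E (tier M) (V - C)"
    using weight_remove_component[OF fin v C, of "tier M"] by (simp only:)
  have finC: "finite C"
    using components_subset[OF C] fin by (meson finite_Diff finite_subset)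
  have "card {x \<in> C. tier M x > tier M v \<and> x < u} = 0 \<longleftrightarrow> (\<forall>x\<in>M \<inter> C. u \<le> x)"
    using M(1) finC by (simp add: tier_def) (meson not_le Int_iff)
  also have "\<dots> \<longleftrightarrow> u = Min (M \<inter> C)"
    using u(1) M(2) finC by (auto intro: Min_eqI[symmetric])
  finally show ?thesis
    unfolding W by simp
qed

section \<open>Joining and splitting trees of weight 0\<close>

text \<open>The new edge ends in the least maximum of the second tree, as weight 0 demands. Removing
  \<open>v\<close> from the maxima only has an effect when the first tree is the single vertex
  \<open>v\<close>, which now gets a larger neighbor.\<close>

definition join :: "'a::linorder \<Rightarrow> 'a set set \<times> 'a set \<Rightarrow> 'a set set \<times> 'a set \<Rightarrow> 'a set set \<times> 'a set" where
  "join v T1 T2 = (insert {v, Min (snd T2)} (fst T1 \<union> fst T2), snd T1 - {v} \<union> snd T2)"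

text \<open>Besides weight 0, the conclusions recover both inputs from the result: \<open>C\<close>
  is a component after deleting \<open>v\<close>, and edges and maxima come back by restriction,
  with an exception for the lone vertex \<open>v\<close>. Injectivity of \<open>join\<close> rests
  on this.\<close>

lemma join_zero_trees:
  assumes fin: "finite V" and v: "v = Min V" "v \<in> V" and C: "C \<subseteq> V - {v}"
    and T1: "(E1, M1) \<in> zero_trees (V - C)" and T2: "(E2, M2) \<in> zero_trees C"
    and J: "join v (E1, M1) (E2, M2) = (E, M)"
  shows "(E, M) \<in> zero_trees V" "C \<in> components (V - {v}) E"
    "E \<inter> Pow C = E2" "E \<inter> Pow (V - C) = E1"
    "M \<inter> C = M2" "(if V - C = {v} then {v} else M - C) = M1"
proof -
  define u where "u = Min M2"
  have E: "E = insert {v, u} (E1 \<union> E2)" and M: "M = M1 - {v} \<union> M2"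
    using J by (auto simp: join_def u_def)
  have t1: "is_tree (V - C) E1" and t2: "is_tree C E2" and M1: "M1 \<subseteq> V - C" "M1 \<noteq> {}"
    and M2: "M2 \<subseteq> C" "M2 \<noteq> {}"
    using T1 T2 by (auto simp: zero_trees_def)
  have finC: "finite C"
    using C fin by (meson finite_Diff finite_subset)
  have u: "u \<in> M2" "u \<in> C"
    using M2 finC finite_subset[OF M2(1)] Min_in[of M2] unfolding u_def by blast+
  have vMin: "v = Min (V - C)"
    by (rule Min_eqI[symmetric]) (use fin v C in auto)
  have vC: "v \<in> V - C"
    using v C by blast
  have "v < u"
    using u v C fin Min_le[of V u] by (metis DiffD1 DiffD2 insertCI order_le_neq_trans subsetD)
  note s1 = is_tree_edge_subset[OF t1] and s2 = is_tree_edge_subset[OF t2]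
  have "V - C \<union> C = V"
    using C by blast
  then have tree: "is_tree V E"
    using tree_join[OF t1 t2 _ vC u(2)] by (simp add: E Int_commute)
  \<comment> \<open>An empty edge would lie in both power sets and spoil the two
    restrictions.\<close>
  have ne: "e \<noteq> {}" if "e \<in> E" for e
    using tree that by (auto simp: is_tree_def simple_graph_def)
  show EC: "E \<inter> Pow C = E2" and EVC: "E \<inter> Pow (V - C) = E1"
    using s1 s2 ne u vC unfolding E by fast+
  show MC: "M \<inter> C = M2"
    using M1 M2 vC by (auto simp: M)
  have M1v: "M1 = {v}" if "V - C = {v}"
    using that M1 by auto
  have vM1: "v \<notin> M1" if "V - C \<noteq> {v}"
    by (rule Min_not_max[OF T1 _ vMin vC that]) (use fin in auto)
  show "(if V - C = {v} then {v} else M - C) = M1"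
    using M1v vM1 M1 M2 by (auto simp: M)
  show comp: "C \<in> components (V - {v}) E"
    unfolding components_iff
  proof (intro conjI ballI)
    show "connected_graph C E"
      using t2 connected_graph_Pow[of C E] by (simp add: EC is_tree_def)
    fix x y assume "x \<in> C" "y \<in> V - {v} - C"
    then show "{x, y} \<notin> E"
      using s1[of "{x, y}"] s2[of "{x, y}"] vC by (auto simp: E doubleton_eq_iff)
  qed (use C in blast)
  have nb: "{v, x} \<in> E \<longleftrightarrow> x = u" if "x \<in> C" for x
    using s1[of "{v, x}"] s2[of "{v, x}"] vC that by (auto simp: E doubleton_eq_iff)
  have vM: "v \<notin> M" and uM: "u \<in> M"
    using vC M2 u by (auto simp: M)
  have "weight E (tier M) C = weight E2 (tier M2) C"
    by (rule weight_cong) (use EC MC in \<open>auto simp: tier_def\<close>)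
  moreover have "weight E (tier M) (V - C) = weight E1 (tier M1) (V - C)"
  proof (cases "V - C = {v}")
    case True
    then show ?thesis
      by (simp add: weight_trivial)
  next
    case False
    show ?thesis
      by (rule weight_cong) (use EVC vM1[OF False] M2 in \<open>auto simp: tier_def M\<close>)
  qed
  ultimately have "weight E (tier M) V = 0"
    using T1 T2 weight_tier_eq_0_iff[OF fin v comp u(2) nb vM uM] MC
    by (simp add: zero_trees_def u_def)
  moreover have "a \<notin> M \<and> b \<in> M" if "{a, b} \<in> E" "a < b" for a b
  proof -
    have "{a, b} = {v, u} \<or> {a, b} \<in> E1 \<or> {a, b} \<in> E2"
      using that(1) by (simp only: E insert_iff Un_iff)
    then show ?thesis
    proof (elim disjE)
      assume "{a, b} = {v, u}"
      then have "a = v" "b = u"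
        using \<open>v < u\<close> that(2) by (auto simp: doubleton_eq_iff)
      then show ?thesis
        using vM uM by simp
    next
      assume "{a, b} \<in> E1"
      then have "a \<notin> M1" "b \<in> M1" "a \<in> V - C"
        using T1 that(2) s1[of "{a, b}"] by (auto simp: zero_trees_def)
      \<comment> \<open>The smallest vertex cannot be the larger end \<open>b\<close>, so dropping
        \<open>v\<close> from \<open>M1\<close> leaves \<open>b\<close> a maximum.\<close>
      moreover have "v \<le> a"
        unfolding v(1) using \<open>a \<in> V - C\<close> fin by (intro Min_le) auto
      then have "b \<noteq> v"
        using \<open>v \<le> a\<close> that(2) by auto
      ultimately show ?thesis
        using M2 by (auto simp: M)
    next
      assume "{a, b} \<in> E2"
      then show ?thesis
        using T2 that(2) s2[of "{a, b}"] M1 by (auto simp: zero_trees_def M)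
    qed
  qed
  ultimately show "(E, M) \<in> zero_trees V"
    using tree M1 M2 C uM by (auto simp: zero_trees_def M)
qed

text \<open>Weight 0 forces the only edge between \<open>v\<close> and \<open>C\<close> to end in
  the least maximum of \<open>C\<close>, so \<open>join\<close> restores exactly the edge that was
  cut.\<close>

lemma split_zero_trees:
  assumes fin: "finite V" and v: "v = Min V" "v \<in> V"
    and T: "(E, M) \<in> zero_trees V" and C: "C \<in> components (V - {v}) E"
  defines "M1 \<equiv> if V - C = {v} then {v} else M - C"
  shows "(E \<inter> Pow (V - C), M1) \<in> zero_trees (V - C)" "(E \<inter> Pow C, M \<inter> C) \<in> zero_trees C"
    "join v (E \<inter> Pow (V - C), M1) (E \<inter> Pow C, M \<inter> C) = (E, M)"
proof -
  have t: "is_tree V E" and MV: "M \<subseteq> V"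
    and col: "\<And>a b. {a, b} \<in> E \<Longrightarrow> a < b \<Longrightarrow> a \<notin> M \<and> b \<in> M"
    using T by (auto simp: zero_trees_def)
  have CV: "C \<subseteq> V - {v}"
    using C by (rule components_subset)
  obtain u where u: "u \<in> C" and E: "insert {v, u} (E \<inter> Pow (V - C) \<union> E \<inter> Pow C) = E"
    using tree_component_edges[OF t v(2) C] by (metis (no_types))
  then have vu: "{v, u} \<in> E"
    by blast
  note vM = Min_neighbor_max(2)[OF T fin v(1) vu] and uM = Min_neighbor_max(3)[OF T fin v(1) vu]
  have nb: "{v, x} \<in> E \<longleftrightarrow> x = u" if "x \<in> C" for x
  proof
    assume "{v, x} \<in> E"
    then have "{v, x} \<in> insert {v, u} (E \<inter> Pow (V - C) \<union> E \<inter> Pow C)"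
      by (simp only: E)
    then show "x = u"
      using that CV by (auto simp: doubleton_eq_iff)
  qed (use vu in simp)
  have w: "u = Min (M \<inter> C)" "weight E (tier M) C = 0" "weight E (tier M) (V - C) = 0"
    using T weight_tier_eq_0_iff[OF fin v C u nb vM uM] by (auto simp: zero_trees_def)
  have M1: "M1 \<subseteq> V - C" "M1 \<noteq> {}"
  proof -
    show "M1 \<subseteq> V - C"
      using MV CV v by (auto simp: M1_def)
    show "M1 \<noteq> {}"
    proof (cases "V - C = {v}")
      case False
      have "connected_graph (V - C) (E \<inter> Pow (V - C))"
        using tree_remove_component[OF t v(2) C] by (simp add: is_tree_def)
      then obtain y where "y \<in> V - C" "{v, y} \<in> E"
        using connected_graph_neighbor[of "V - C" _ v] False v CV by blast
      then show ?thesis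
        using Min_neighbor_max(3)[OF T fin v(1)] False by (auto simp: M1_def)
    qed (simp add: M1_def)
  qed
  have "weight (E \<inter> Pow C) (tier (M \<inter> C)) C = weight E (tier M) C"
    by (rule weight_cong) (auto simp: tier_def)
  then show "(E \<inter> Pow C, M \<inter> C) \<in> zero_trees C"
    using tree_component[OF t C] w(2) u uM col by (auto simp: zero_trees_def)
  have "weight (E \<inter> Pow (V - C)) (tier M1) (V - C) = 0"
  proof (cases "V - C = {v}")
    case True
    then show ?thesis
      by (simp add: weight_trivial)
  next
    case False
    then have "weight (E \<inter> Pow (V - C)) (tier M1) (V - C) = weight E (tier M) (V - C)"
      by (intro weight_cong) (auto simp: tier_def M1_def)
    then show ?thesis
      using w(3) by simp
  qed
  moreover have "a \<notin> M1 \<and> b \<in> M1" if "{a, b} \<in> E \<inter> Pow (V - C)" "a < b" for a b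
    using col[of a b] that by (auto simp: M1_def)
  ultimately show "(E \<inter> Pow (V - C), M1) \<in> zero_trees (V - C)"
    using tree_remove_component[OF t v(2) C] M1 by (auto simp: zero_trees_def)
  have "M1 - {v} \<union> M \<inter> C = M"
    using MV vM by (auto simp: M1_def)
  then show "join v (E \<inter> Pow (V - C), M1) (E \<inter> Pow C, M \<inter> C) = (E, M)"
    using E w(1) by (simp only: join_def fst_conv snd_conv)
qed

text \<open>The maxima of the two parts are disjoint, and \<open>v\<close> is lost from them exactly
  when it is the whole first tree.\<close>

lemma card_join:
  assumes fin: "finite V" and v: "v = Min V" "v \<in> V" and C: "C \<subseteq> V - {v}"
    and T1: "T1 \<in> zero_trees (V - C)" and T2: "T2 \<in> zero_trees C"
  shows "card (snd (join v T1 T2)) =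
    (if V - C = {v} then card (snd T2) else card (snd T1) + card (snd T2))"
proof -
  have M: "snd T1 \<subseteq> V - C" "snd T1 \<noteq> {}" "snd T2 \<subseteq> C"
    using T1 T2 by (auto simp: zero_trees_def)
  have "finite (snd T1)" "finite (snd T2)"
    using M C fin by (meson finite_Diff finite_subset)+
  then have card: "card (snd (join v T1 T2)) = card (snd T1 - {v}) + card (snd T2)"
    unfolding join_def snd_conv using M by (intro card_Un_disjoint) auto
  show ?thesis
  proof (cases "V - C = {v}")
    case True
    then have "snd T1 - {v} = {}"
      using M by blast
    then have "card (snd T1 - {v}) = 0"
      by (simp only: card.empty)
    then show ?thesis
      using card True by simp
  next
    case False
    have vMin: "v = Min (V - C)"
      by (rule Min_eqI[symmetric]) (use fin v C in auto)
    have "v \<notin> snd T1"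
      by (rule Min_not_max[of "fst T1" _ "V - C"]) (use T1 fin vMin v C False in auto)
    then show ?thesis
      using card False by simp
  qed
qed

text \<open>The second smallest element marks the part \<open>C\<close>, so that the split can be
  read off from the tree or word built from it.\<close>

definition splits :: "'a::linorder set \<Rightarrow> 'a set set" where
  "splits V = {C. Min (V - {Min V}) \<in> C \<and> C \<subseteq> V - {Min V}}"

text \<open>Injective, since \<open>C\<close> must be the component that contains \<open>w\<close>,
  after which both trees are recovered by restriction; surjective, by cutting off that
  component.\<close>

lemma bij_betw_join:
  assumes fin: "finite V" and v: "v = Min V" and nontriv: "V - {v} \<noteq> {}"
  shows "bij_betw (\<lambda>(C, T1, T2). join v T1 T2)
    (SIGMA C:splits V. zero_trees (V - C) \<times> zero_trees C) (zero_trees V)"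
proof -
  have vV: "v \<in> V"
    unfolding v using nontriv by (intro Min_in fin) auto
  define w where "w = Min (V - {v})"
  have w: "w \<in> V - {v}"
    unfolding w_def using nontriv fin by (intro Min_in) auto
  have splits: "C \<in> splits V \<longleftrightarrow> w \<in> C \<and> C \<subseteq> V - {v}" for C
    by (simp add: splits_def w_def v)
  show ?thesis
  proof (rule bij_betw_imageI)
    show "inj_on (\<lambda>(C, T1, T2). join v T1 T2)
      (SIGMA C:splits V. zero_trees (V - C) \<times> zero_trees C)"
    proof (rule inj_onI)
      fix p p'
      assume mem: "p \<in> (SIGMA C:splits V. zero_trees (V - C) \<times> zero_trees C)"
          "p' \<in> (SIGMA C:splits V. zero_trees (V - C) \<times> zero_trees C)"
        and eq: "(\<lambda>(C, T1, T2). join v T1 T2) p = (\<lambda>(C, T1, T2). join v T1 T2) p'"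
      obtain C E1 M1 E2 M2 C' E1' M1' E2' M2' where p: "p = (C, (E1, M1), (E2, M2))"
        "p' = (C', (E1', M1'), (E2', M2'))"
        by (metis prod.collapse)
      have C: "C \<in> splits V" "C' \<in> splits V"
        and T: "(E1, M1) \<in> zero_trees (V - C)" "(E2, M2) \<in> zero_trees C"
          "(E1', M1') \<in> zero_trees (V - C')" "(E2', M2') \<in> zero_trees C'"
        using mem by (auto simp: p)
      obtain E M where J: "join v (E1, M1) (E2, M2) = (E, M)" "join v (E1', M1') (E2', M2') = (E, M)"
        using eq by (cases "join v (E1, M1) (E2, M2)") (simp add: p)
      have w: "w \<in> C" "w \<in> C'" and sub: "C \<subseteq> V - {v}" "C' \<subseteq> V - {v}"
        using C by (auto simp: splits)
      note j = join_zero_trees[OF fin v vV sub(1) T(1,2) J(1)]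
      note j' = join_zero_trees[OF fin v vV sub(2) T(3,4) J(2)]
      have "C = C'"
        using components_unique[OF j(2) j'(2) w] .
      moreover have "M1 = M1'"
        using j(6) unfolding \<open>C = C'\<close> j'(6) by (rule sym)
      ultimately show "p = p'"
        using j(3-5) j'(3-5) by (simp add: p)
    qed
    have "join v T1 T2 \<in> zero_trees V"
      if "C \<in> splits V" "T1 \<in> zero_trees (V - C)" "T2 \<in> zero_trees C" for C T1 T2
      using join_zero_trees(1)[OF fin v vV, of C "fst T1" "snd T1" "fst T2" "snd T2"] that
      by (cases "join v T1 T2") (auto simp: splits)
    moreover have "T \<in> (\<lambda>(C, T1, T2). join v T1 T2) `
      (SIGMA C:splits V. zero_trees (V - C) \<times> zero_trees C)" if T: "T \<in> zero_trees V" for T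
    proof -
      obtain E M where EM: "T = (E, M)"
        by (cases T)
      define C where "C = reachable (V - {v}) E `` {w}"
      have C: "C \<in> components (V - {v}) E"
        using w by (auto simp: C_def components_def intro: quotientI)
      moreover have "w \<in> C"
        using w by (simp add: C_def reachable_iff)
      ultimately have "C \<in> splits V"
        using components_subset[OF C] by (simp add: splits)
      then show ?thesis
        using split_zero_trees[OF fin v vV T[unfolded EM] C]
        by (intro image_eqI[of _ _ "(C, (_, _), (_, _))"]) (auto simp: EM)
    qed
    ultimately show "(\<lambda>(C, T1, T2). join v T1 T2) `
      (SIGMA C:splits V. zero_trees (V - C) \<times> zero_trees C) = zero_trees V"
      by auto
  qed
qed

section \<open>Words\<close>

fun des :: "'a::linorder list \<Rightarrow> nat" where
  "des (x # y # xs) = of_bool (x > y) + des (y # xs)"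
| "des _ = 0"

lemma des_append:
  "xs \<noteq> [] \<Longrightarrow> ys \<noteq> [] \<Longrightarrow> des (xs @ ys) = des xs + of_bool (last xs > hd ys) + des ys"
proof (induction xs rule: des.induct)
  case ("2_2" x)
  then show ?case
    by (cases ys) auto
qed auto

text \<open>Turns the recursive count into the size of an index set, the form used by
  \<open>descents\<close>. The induction splits off the first index.\<close>

lemma des_map_upt:
  "des (map g [a..<b]) = card {i. a \<le> i \<and> Suc i < b \<and> g i > g (Suc i)}"
proof (induction "b - a" arbitrary: a)
  case 0
  then have "[a..<b] = []" "{i. a \<le> i \<and> Suc i < b \<and> g i > g (Suc i)} = {}"
    by auto
  then show ?case
    by (simp only: list.map des.simps card.empty)
next
  case (Suc m)
  show ?case
  proof (cases "Suc a < b")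
    case False
    then have "[a..<b] = [a]" "{i. a \<le> i \<and> Suc i < b \<and> g i > g (Suc i)} = {}"
      using Suc.hyps(2) by (auto simp: upt_rec)
    then show ?thesis
      by (simp only: list.map des.simps card.empty)
  next
    case True
    let ?D = "\<lambda>a. {i. a \<le> i \<and> Suc i < b \<and> g i > g (Suc i)}"
    have "finite (?D (Suc a))"
      by (rule finite_subset[of _ "{..<b}"]) auto
    moreover have "?D a = (if g a > g (Suc a) then insert a (?D (Suc a)) else ?D (Suc a))"
      using True by (auto simp: Suc_le_eq order.order_iff_strict)
    ultimately have "card (?D a) = of_bool (g a > g (Suc a)) + card (?D (Suc a))"
      by simp
    moreover have "des (map g [a..<b]) = of_bool (g a > g (Suc a)) + des (map g [Suc a..<b])"
      using True by (simp add: upt_conv_Cons)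
    moreover have "des (map g [Suc a..<b]) = card (?D (Suc a))"
      by (rule Suc.hyps(1)) (use Suc.hyps(2) in simp)
    ultimately show ?thesis
      by simp
  qed
qed

section \<open>Words that begin with their minimum\<close>

definition words :: "'a::linorder set \<Rightarrow> 'a list set" where
  "words V = {xs. distinct xs \<and> set xs = V \<and> hd xs = Min V}"

lemma words_singleton: "words {v} = {[v]}"
proof -
  have "xs = [v]" if "distinct xs" "set xs = {v}" for xs
    using that by (cases xs; cases "tl xs") auto
  then show ?thesis
    by (auto simp: words_def)
qed

text \<open>Prepares the induction: both parts are nonempty proper subsets, and their minima are the
  two smallest elements of \<open>V\<close>.\<close>

lemma splits_Min:
  assumes "finite V" "V \<noteq> {}" "C \<in> splits V"
  shows "Min C = Min (V - {Min V})" "Min (V - C) = Min V" "C \<noteq> {}" "V - C \<noteq> {}"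
    "C \<subset> V" "V - C \<subset> V"
proof -
  have C: "Min (V - {Min V}) \<in> C" "C \<subseteq> V - {Min V}"
    using assms(3) by (auto simp: splits_def)
  have "Min V \<in> V"
    using assms(1,2) by (rule Min_in)
  show "Min C = Min (V - {Min V})"
    by (rule Min_eqI) (use C assms(1) finite_subset[OF C(2)] in \<open>auto intro!: Min_le\<close>)
  show "Min (V - C) = Min V"
    by (rule Min_eqI) (use C assms(1) \<open>Min V \<in> V\<close> in auto)
  show "C \<noteq> {}" "V - C \<noteq> {}" "C \<subset> V" "V - C \<subset> V"
    using C \<open>Min V \<in> V\<close> by blast+
qed

text \<open>The letter \<open>w\<close> occurs once in \<open>xs @ ys\<close>, as the first letter
  of \<open>ys\<close>, so the word determines where it was cut.\<close>

lemma bij_betw_append: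
  assumes fin: "finite V" and nontriv: "V - {Min V} \<noteq> {}"
  shows "bij_betw (\<lambda>(C, xs, ys). xs @ ys)
    (SIGMA C:splits V. words (V - C) \<times> words C) (words V)"
proof -
  define w where "w = Min (V - {Min V})"
  have ne: "V \<noteq> {}"
    using nontriv by blast
  have w: "w \<in> V - {Min V}"
    unfolding w_def using nontriv fin by (intro Min_in) auto
  note m = splits_Min[OF fin ne, folded w_def]
  have shape: "\<exists>zs. ys = w # zs \<and> w \<notin> set xs \<and> w \<notin> set zs"
    if "C \<in> splits V" "xs \<in> words (V - C)" "ys \<in> words C" for C xs ys
    using that m[OF that(1)] by (cases ys) (auto simp: words_def splits_def w_def[symmetric])
  show ?thesis
  proof (rule bij_betw_imageI)
    show "inj_on (\<lambda>(C, xs, ys). xs @ ys) (SIGMA C:splits V. words (V - C) \<times> words C)"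
    proof (rule inj_onI)
      fix p p'
      assume mem: "p \<in> (SIGMA C:splits V. words (V - C) \<times> words C)"
          "p' \<in> (SIGMA C:splits V. words (V - C) \<times> words C)"
        and app: "(\<lambda>(C, xs, ys). xs @ ys) p = (\<lambda>(C, xs, ys). xs @ ys) p'"
      obtain C xs ys C' xs' ys' where p: "p = (C, xs, ys)" "p' = (C', xs', ys')"
        by (metis prod.collapse)
      have *: "C \<in> splits V" "xs \<in> words (V - C)" "ys \<in> words C"
        and **: "C' \<in> splits V" "xs' \<in> words (V - C')" "ys' \<in> words C'"
        and eq: "xs @ ys = xs' @ ys'"
        using mem app by (auto simp: p)
      have "xs = xs' \<and> ys = ys'"
        using shape[OF *] shape[OF **] eq by (auto simp: append_Cons_eq_iff)
      \<comment> \<open>The set \<open>C\<close> is recovered as the set of letters of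
        \<open>ys\<close>.\<close>
      then show "p = p'"
        using * ** by (auto simp: p words_def)
    qed
    have "xs @ ys \<in> words V"
      if C: "C \<in> splits V" and "xs \<in> words (V - C)" "ys \<in> words C" for C xs ys
    proof -
      have "C \<subseteq> V"
        using C by (auto simp: splits_def)
      moreover have "xs \<noteq> []"
        using that m(4)[OF C] by (auto simp: words_def)
      ultimately show ?thesis
        using that m(2)[OF C] by (auto simp: words_def)
    qed
    moreover have "zs \<in> (\<lambda>(C, xs, ys). xs @ ys) ` (SIGMA C:splits V. words (V - C) \<times> words C)"
      if zs: "zs \<in> words V" for zs
    proof -
      have d: "distinct zs" "set zs = V" "hd zs = Min V"
        using zs by (auto simp: words_def)
      obtain xs ys where xy: "zs = xs @ w # ys"
        using w d split_list[of w zs] by blast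
      have "xs \<noteq> []"
        using xy d w by auto
      then have "hd xs = Min V"
        using xy d(3) by simp
      moreover have "hd xs \<in> set xs"
        using \<open>xs \<noteq> []\<close> by (rule hd_in_set)
      ultimately have hd: "hd xs = Min V" "Min V \<in> set xs"
        by simp_all
      have C: "set (w # ys) \<in> splits V"
        using xy d hd by (auto simp: splits_def w_def[symmetric])
      have "V - set (w # ys) = set xs"
        using xy d by auto
      then have "xs \<in> words (V - set (w # ys))"
        using hd m(2)[OF C] xy d(1) by (simp add: words_def)
      moreover have "w # ys \<in> words (set (w # ys))"
        using m(1)[OF C] xy d(1) by (simp add: words_def)
      ultimately show ?thesis
        using C xy by (intro image_eqI[of _ _ "(set (w # ys), xs, w # ys)"]) auto
    qed
    ultimately show "(\<lambda>(C, xs, ys). xs @ ys) ` (SIGMA C:splits V. words (V - C) \<times> words C) = words V"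
      by auto
  qed
qed

text \<open>The second part begins with the second smallest letter. In front of it stands either
  \<open>Min V\<close> alone, giving an ascent, or a word whose last letter is larger, giving one
  new descent.\<close>

lemma des_append_words:
  assumes fin: "finite V" and ne: "V \<noteq> {}" and C: "C \<in> splits V"
    and xs: "xs \<in> words (V - C)" and ys: "ys \<in> words C"
  shows "des (xs @ ys) =
    (if V - C = {Min V} then des ys else des xs + des ys + 1)"
proof -
  note m = splits_Min[OF fin ne C]
  have nonempty: "xs \<noteq> []" "ys \<noteq> []"
    using xs ys m(3,4) by (auto simp: words_def)
  have hd_ys: "hd ys = Min (V - {Min V})"
    using ys m(1) by (simp add: words_def)
  have "Min V \<in> V"
    using fin ne by (rule Min_in)
  have wC: "Min (V - {Min V}) \<in> C" "C \<subseteq> V - {Min V}"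
    using C by (auto simp: splits_def)
  have x: "distinct xs" "set xs = V - C" "hd xs = Min V"
    using xs m(2) by (auto simp: words_def)
  show ?thesis
  proof (cases "V - C = {Min V}")
    case True
    then have "xs = [Min V]"
      using xs unfolding True words_singleton by simp
    moreover have "Min V \<le> hd ys"
      using wC fin hd_ys by auto
    ultimately show ?thesis
      using True nonempty(2) by (cases ys) auto
  next
    case False
    obtain z zs where z: "xs = z # zs"
      using nonempty(1) by (cases xs) auto
    have "zs \<noteq> []"
      using False x z by auto
    then have "last xs \<in> set zs"
      using z by simp
    then have "last xs \<noteq> Min V"
      using x(1,3) z by auto
    moreover have "last xs \<in> V - C"
      using last_in_set[OF nonempty(1)] x(2) by simp
    ultimately have "last xs \<in> V - {Min V}" "last xs \<notin> C"
      by simp_all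
    then have "hd ys \<le> last xs" "hd ys \<noteq> last xs"
      using hd_ys wC fin by auto
    then show ?thesis
      using False nonempty by (simp add: des_append)
  qed
qed

section \<open>The recursive bijection between words and trees\<close>

lemma bij_betw_Sigma_fibres:
  assumes "\<And>c. c \<in> P \<Longrightarrow> bij_betw (f c) (A c) (B c)"
  shows "bij_betw (\<lambda>(c, x). (c, f c x)) (Sigma P A) (Sigma P B)"
  using assms by (force simp: bij_betw_def inj_on_def image_iff)

lemma bij_betw_filter:
  assumes "bij_betw f A B" and "\<And>x. x \<in> A \<Longrightarrow> Q (f x) \<longleftrightarrow> P x"
  shows "bij_betw f {x \<in> A. P x} {y \<in> B. Q y}"
  using assms by (auto simp: bij_betw_def inj_on_def)

text \<open>Cut the word, map both parts by induction, join the trees. The counts agree: for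
  \<open>V - C = {v}\<close> both sides come from the second part alone, and otherwise
  \<open>(des xs + 1) + (des ys + 1)\<close> is the new number of descents plus 1.\<close>

lemma words_zero_trees_bij:
  fixes V :: "'a::linorder set"
  assumes "finite V" "V \<noteq> {}"
  shows "\<exists>f. bij_betw f (words V) (zero_trees V) \<and>
    (\<forall>xs\<in>words V. card (snd (f xs)) = des xs + 1)"
  using assms
proof (induction rule: finite_psubset_induct)
  case (psubset V)
  define v where "v = Min V"
  have vV: "v \<in> V"
    unfolding v_def using psubset by (intro Min_in) auto
  show ?case
  proof (cases "V = {v}")
    case True
    have "bij_betw (\<lambda>_. ({}, {v})) (words {v}) (zero_trees {v})"
      by (simp add: words_singleton zero_trees_singleton bij_betw_def)
    then show ?thesis
      unfolding True by (intro exI[of _ "\<lambda>_. ({}, {v})"]) (simp add: words_singleton)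
  next
    case False
    have nontriv: "V - {v} \<noteq> {}"
      using False vV by blast
    \<comment> \<open>The existential stands outside the conditions on \<open>U\<close>, so that one
      choice function \<open>F\<close> covers all subsets.\<close>
    have "\<forall>U. \<exists>f. U \<subset> V \<longrightarrow> U \<noteq> {} \<longrightarrow> bij_betw f (words U) (zero_trees U) \<and>
        (\<forall>xs\<in>words U. card (snd (f xs)) = des xs + 1)"
      using psubset.IH by blast
    then obtain F where "\<forall>U. U \<subset> V \<longrightarrow> U \<noteq> {} \<longrightarrow> bij_betw (F U) (words U) (zero_trees U) \<and>
        (\<forall>xs\<in>words U. card (snd (F U xs)) = des xs + 1)"
      by metis
    then have F: "bij_betw (F U) (words U) (zero_trees U)"
        "\<And>xs. xs \<in> words U \<Longrightarrow> card (snd (F U xs)) = des xs + 1" if "U \<subset> V" "U \<noteq> {}" for U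
      using that by auto
    let ?W = "SIGMA C:splits V. words (V - C) \<times> words C"
    let ?T = "SIGMA C:splits V. zero_trees (V - C) \<times> zero_trees C"
    define g where "g = (\<lambda>(C, x). (C, map_prod (F (V - C)) (F C) x))"
    \<comment> \<open>The map that cuts a word, obtained as the inverse of concatenation.\<close>
    define h where "h = inv_into ?W (\<lambda>(C, xs, ys). xs @ ys)"
    define j where "j = (\<lambda>(C :: 'a set, T1, T2). join v T1 T2)"
    note m = splits_Min[OF psubset.hyps psubset.prems]
    have app: "bij_betw (\<lambda>(C, xs, ys). xs @ ys) ?W (words V)"
      using bij_betw_append psubset.hyps nontriv by (simp add: v_def)
    then have h: "bij_betw h (words V) ?W"
      unfolding h_def by (rule bij_betw_inv_into)
    have "bij_betw g ?W ?T"
      unfolding g_def by (intro bij_betw_Sigma_fibres bij_betw_map_prod F m)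
    moreover have "bij_betw j ?T (zero_trees V)"
      unfolding j_def by (rule bij_betw_join[OF psubset.hyps v_def nontriv])
    ultimately have "bij_betw (j \<circ> (g \<circ> h)) (words V) (zero_trees V)"
      using h by (blast intro: bij_betw_trans)
    moreover have "card (snd ((j \<circ> (g \<circ> h)) zs)) = des zs + 1" if zs: "zs \<in> words V" for zs
    proof -
      obtain C xs ys where hz: "h zs = (C, xs, ys)"
        by (cases "h zs")
      have mem: "C \<in> splits V" "xs \<in> words (V - C)" "ys \<in> words C"
        using bij_betwE[OF h] zs hz by force+
      have jgh: "(j \<circ> (g \<circ> h)) zs = join v (F (V - C) xs) (F C ys)"
        by (simp add: hz g_def j_def)
      have "(\<lambda>(C, xs, ys). xs @ ys) (h zs) = zs"
        unfolding h_def by (rule bij_betw_inv_into_right[OF app zs])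
      then have "zs = xs @ ys"
        by (simp add: hz)
      moreover have "F (V - C) xs \<in> zero_trees (V - C)" "F C ys \<in> zero_trees C"
        using mem F(1) m[OF mem(1)] by (auto dest: bij_betwE)
      moreover have "C \<subseteq> V - {v}"
        using mem(1) by (auto simp: splits_def v_def)
      moreover have "card (snd (F (V - C) xs)) = des xs + 1" "card (snd (F C ys)) = des ys + 1"
        using mem F(2) m[OF mem(1)] by auto
      ultimately show ?thesis
        unfolding jgh using card_join[OF psubset.hyps v_def vV, of C "F (V - C) xs" "F C ys"]
          des_append_words[OF psubset.hyps psubset.prems mem]
        by (simp add: v_def[symmetric])
    qed
    ultimately show ?thesis
      by blast
  qed
qed

section \<open>Permutations and maxmin trees\<close>

text \<open>Shifting the values up makes room for the letter 1 in front, which creates no descent.\<close>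

definition perm_word :: "nat \<Rightarrow> (nat \<Rightarrow> nat) \<Rightarrow> nat list" where
  "perm_word n p = 1 # map (\<lambda>i. Suc (p i)) [1..<n + 1]"

lemma des_perm_word:
  assumes "p permutes {1..n}"
  shows "des (perm_word n p) = card (descents n p)"
proof -
  \<comment> \<open>Index 0 carries the leading letter 1, which never exceeds
    \<open>Suc (p 1)\<close>; hence index 0 adds nothing to the count.\<close>
  define g where "g i = (if i = 0 then 1 else Suc (p i))" for i
  have "perm_word n p = map g [0..<n + 1]"
    by (auto simp: perm_word_def g_def upt_conv_Cons[of 0] simp del: upt_Suc)
  then have "des (perm_word n p) = card {i. 0 \<le> i \<and> Suc i < n + 1 \<and> g i > g (Suc i)}"
    by (simp only: des_map_upt)
  also have "{i. 0 \<le> i \<and> Suc i < n + 1 \<and> g i > g (Suc i)} = descents n p"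
    by (auto simp: g_def descents_def Suc_le_eq)
  finally show ?thesis .
qed

lemma bij_betw_perm_word: "bij_betw (perm_word n) {p. p permutes {1..n}} (words {1..n + 1})"
proof (rule bij_betw_imageI)
  show "inj_on (perm_word n) {p. p permutes {1..n}}"
  proof (rule inj_onI, clarify)
    fix p q :: "nat \<Rightarrow> nat"
    assume p: "p permutes {1..n}" and q: "q permutes {1..n}" and eq: "perm_word n p = perm_word n q"
    have "p i = q i" if "i \<in> {1..n}" for i
      using eq that by (auto simp: perm_word_def simp del: upt_Suc)
    moreover have "p i = q i" if "i \<notin> {1..n}" for i
      using permutes_not_in[OF p that] permutes_not_in[OF q that] by simp
    ultimately show "p = q"
      by blast
  qed
  have Min: "Min {1..n + 1} = 1"
    by (intro Min_eqI) auto
  have ivl: "set [1..<n + 1] = {1..n}"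
    by (simp add: atLeastLessThanSuc_atLeastAtMost del: upt_Suc)
  have "perm_word n p \<in> words {1..n + 1}" if p: "p permutes {1..n}" for p
  proof -
    have "set (perm_word n p) = insert 1 (Suc ` p ` {1..n})"
      unfolding perm_word_def list.set set_map ivl image_image ..
    also have "\<dots> = {1..n + 1}"
      unfolding permutes_image[OF p] by (auto simp: image_Suc_atLeastAtMost)
    finally have "set (perm_word n p) = {1..n + 1}" .
    \<comment> \<open>Excludes a second letter 1, which would be \<open>Suc 0\<close>.\<close>
    moreover have "0 \<notin> p ` {1..n}"
      using permutes_image[OF p] by simp
    then have "distinct (perm_word n p)"
      unfolding perm_word_def distinct.simps distinct_map set_map ivl
      using permutes_inj[OF p] by (force simp: inj_on_def inj_def simp del: upt_Suc)
    moreover have "hd (perm_word n p) = 1"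
      by (simp add: perm_word_def)
    ultimately show ?thesis
      using Min by (simp add: words_def)
  qed
  moreover have "zs \<in> perm_word n ` {p. p permutes {1..n}}" if "zs \<in> words {1..n + 1}" for zs
  proof -
    have z: "distinct zs" "set zs = {1..n + 1}" "hd zs = 1"
      using that Min by (auto simp: words_def)
    then obtain ys where ys: "zs = 1 # ys"
      by (cases zs) auto
    have "distinct ys" "1 \<notin> set ys" "insert 1 (set ys) = {1..n + 1}"
      using z ys by simp_all
    then have "set ys = {1..n + 1} - {1}"
      by blast
    also have "\<dots> = {2..n + 1}"
      by auto
    finally have set: "set ys = {2..n + 1}" .
    have len: "length ys = n"
      using distinct_card[OF \<open>distinct ys\<close>] set by simp
    \<comment> \<open>Undoes both shifts: list positions start at 0, and the letters after the first
      are one larger than the values. Outside \<open>{1..n}\<close> a permutation must be the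
      identity.\<close>
    define p where "p i = (if i \<in> {1..n} then ys ! (i - 1) - 1 else i)" for i
    have nth: "ys ! (i - 1) \<in> {2..n + 1}" if "i \<in> {1..n}" for i
      using that len nth_mem[of "i - 1" ys] set by auto
    have "inj_on p {1..n}"
    proof (rule inj_onI)
      fix i k assume i: "i \<in> {1..n}" and k: "k \<in> {1..n}" and "p i = p k"
      then have "ys ! (i - 1) = ys ! (k - 1)"
        using nth[OF i] nth[OF k] by (simp add: p_def) arith
      moreover have "i - 1 < length ys" "k - 1 < length ys"
        using i k len by auto
      ultimately have "i - 1 = k - 1"
        using nth_eq_iff_index_eq[OF \<open>distinct ys\<close>] by blast
      then show "i = k"
        using i k by simp arith
    qed
    moreover have "p ` {1..n} \<subseteq> {1..n}"
      using nth by (fastforce simp: p_def)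
    ultimately have "bij_betw p {1..n} {1..n}"
      by (simp add: bij_betw_def endo_inj_surj)
    then have "p permutes {1..n}"
      by (rule bij_imp_permutes) (auto simp: p_def)
    moreover have "map (\<lambda>i. Suc (p i)) [1..<n + 1] = ys"
    proof (rule nth_equalityI)
      fix i assume "i < length (map (\<lambda>i. Suc (p i)) [1..<n + 1])"
      then have "i < n"
        by (simp del: upt_Suc)
      then show "map (\<lambda>i. Suc (p i)) [1..<n + 1] ! i = ys ! i"
        using nth[of "Suc i"] by (simp add: p_def del: upt_Suc)
    qed (simp add: len)
    ultimately show ?thesis
      by (intro image_eqI[of _ _ p]) (simp_all add: perm_word_def ys)
  qed
  ultimately show "perm_word n ` {p. p permutes {1..n}} = words {1..n + 1}"
    by auto
qed

section \<open>Maxmin trees and their encoding by sets of maxima\<close>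

text \<open>Vertex 1 has a neighbor because \<open>N \<ge> 2\<close>; it is larger, so it has a
  larger tier, and both tiers occur.\<close>

lemma maxmin_tree_surj:
  fixes t :: "nat \<Rightarrow> nat"
  assumes tree: "is_tree {1..N} E" and N: "N \<ge> 2" and range: "t ` {1..N} \<subseteq> {1, 2}"
    and mono: "\<And>v v'. {v, v'} \<in> E \<Longrightarrow> v > v' \<Longrightarrow> t v > t v'"
  shows "t ` {1..N} = {1, 2}"
proof -
  have "connected_graph {1..N} E" "(1::nat) \<in> {1..N}" "{1..N} \<noteq> {1::nat}"
    using tree N by (auto simp: is_tree_def)
  then obtain u where u: "u \<in> {1..N}" "{1, u} \<in> E"
    by (rule connected_graph_neighbor)
  then have "u > 1"
    using is_tree_edge_neq[OF tree u(2)] by auto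
  then have "t u > t 1"
    using mono[of u 1] u(2) by (simp add: insert_commute)
  moreover have "t u \<in> {1, 2}" "t 1 \<in> {1, 2}"
    using range u(1) \<open>1 \<in> {1..N}\<close> by blast+
  ultimately have "t u = 2" "t 1 = 1"
    by auto
  then show ?thesis
    using range u(1) \<open>1 \<in> {1..N}\<close> by (metis empty_subsetI imageI insert_subset subset_antisym)
qed

text \<open>The ends of an edge are distinct, so the order condition makes their tiers differ;
  \<open>maxmin_tree_surj\<close> gives both tiers. This shortens the checks below.\<close>

lemma maxmin_tree_iff:
  assumes N: "N \<ge> 2"
  shows "maxmin_tree N E t \<longleftrightarrow> is_tree {1..N} E \<and> t \<in> extensional {1..N} \<and> t ` {1..N} \<subseteq> {1, 2} \<and>
    (\<forall>v v'. {v, v'} \<in> E \<and> v > v' \<longrightarrow> t v > t v')" (is "_ \<longleftrightarrow> ?R")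
proof
  assume R: ?R
  then have t: "is_tree {1..N} E" and mono: "\<And>v v'. {v, v'} \<in> E \<Longrightarrow> v > v' \<Longrightarrow> t v > t v'"
    by simp_all
  have "t v \<noteq> t v'" if e: "{v, v'} \<in> E" for v v'
    using mono[of v v'] mono[of v' v] e is_tree_edge_neq[OF t e]
    by (cases v v' rule: linorder_cases) (auto simp: insert_commute)
  moreover have "t ` {1..N} = {1, 2}"
    using maxmin_tree_surj[OF t N _ mono] R by simp
  ultimately show "maxmin_tree N E t"
    using R by (simp add: maxmin_tree_def)
qed (auto simp: maxmin_tree_def)

text \<open>A tiering with values 1 and 2 is determined by its maxima; \<open>restrict\<close> makes
  it extensional. For \<open>N = 1\<close> the claim fails, since \<open>zero_trees\<close> counts
  the lone vertex while no tiering is surjective.\<close>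

lemma bij_betw_zero_trees_maxmin:
  assumes N: "N \<ge> 2"
  shows "bij_betw (\<lambda>(E, M). (E, restrict (tier M) {1..N})) (zero_trees {1..N})
    {(E, t). maxmin_tree N E t \<and> weight E t {1..N} = 0}"
proof (rule bij_betw_byWitness[where f' = "\<lambda>(E, t). (E, maxima N t)"])
  have maxima: "maxima N (restrict (tier M) {1..N}) = M" if "M \<subseteq> {1..N}" for M
    using that by (auto simp: maxima_def tier_def)
  then show "\<forall>T\<in>zero_trees {1..N}.
      (\<lambda>(E, t). (E, maxima N t)) ((\<lambda>(E, M). (E, restrict (tier M) {1..N})) T) = T"
    by (auto simp: zero_trees_def)
  have tier_maxima: "restrict (tier (maxima N t)) {1..N} = t" if "maxmin_tree N E t" for E t
  proof
    fix x
    show "restrict (tier (maxima N t)) {1..N} x = t x"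
    proof (cases "x \<in> {1..N}")
      case True
      then have "t x \<in> {1, 2}"
        using that unfolding maxmin_tree_def by blast
      then show ?thesis
        using True by (auto simp: maxima_def tier_def)
    next
      case False
      then show ?thesis
        using that by (auto simp: maxmin_tree_def extensional_def)
    qed
  qed
  then show "\<forall>T\<in>{(E, t). maxmin_tree N E t \<and> weight E t {1..N} = 0}.
      (\<lambda>(E, M). (E, restrict (tier M) {1..N})) ((\<lambda>(E, t). (E, maxima N t)) T) = T"
    by auto
  have weight: "weight E (restrict t {1..N}) {1..N} = weight E t {1..N}" for E and t :: "nat \<Rightarrow> nat"
    by (rule weight_cong) auto
  have "maxmin_tree N E (restrict (tier M) {1..N})" if T: "(E, M) \<in> zero_trees {1..N}" for E M
  proof -
    have t: "is_tree {1..N} E"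
      using T by (simp add: zero_trees_def)
    have "restrict (tier M) {1..N} v > restrict (tier M) {1..N} v'" if "{v, v'} \<in> E" "v > v'" for v v'
    proof -
      have "v \<in> {1..N}" "v' \<in> {1..N}"
        using is_tree_edge_subset[OF t that(1)] by auto
      moreover have "v' \<notin> M" "v \<in> M"
        using T that by (auto simp: zero_trees_def insert_commute)
      ultimately show ?thesis
        by (simp add: tier_def)
    qed
    then show ?thesis
      using t by (auto simp: maxmin_tree_iff[OF N] tier_def)
  qed
  then show "(\<lambda>(E, M). (E, restrict (tier M) {1..N})) ` zero_trees {1..N}
      \<subseteq> {(E, t). maxmin_tree N E t \<and> weight E t {1..N} = 0}"
    using weight by (auto simp: zero_trees_def)
  have "(E, maxima N t) \<in> zero_trees {1..N}"
    if T: "maxmin_tree N E t" "weight E t {1..N} = 0" for E t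
  proof -
    have t: "is_tree {1..N} E"
      using T by (simp add: maxmin_tree_def)
    have "weight E (tier (maxima N t)) {1..N} = 0"
      using T(2) weight[of E "tier (maxima N t)"] tier_maxima[OF T(1)] by simp
    moreover have "maxima N t \<subseteq> {1..N}"
      by (auto simp: maxima_def)
    moreover have "maxima N t \<noteq> {}"
    proof -
      have "2 \<in> t ` {1..N}"
        using T(1) by (simp add: maxmin_tree_def)
      then show ?thesis
        by (auto simp: maxima_def)
    qed
    moreover have "a \<notin> maxima N t \<and> b \<in> maxima N t" if "{a, b} \<in> E" "a < b" for a b
    proof -
      have "a \<in> {1..N}" "b \<in> {1..N}"
        using is_tree_edge_subset[OF t that(1)] by auto
      moreover from this have "t a \<in> {1, 2}" "t b \<in> {1, 2}"
        using T(1) unfolding maxmin_tree_def by blast+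
      moreover have "t b > t a"
        using T(1) that by (auto simp: maxmin_tree_iff[OF N] insert_commute)
      ultimately show ?thesis
        by (auto simp: maxima_def)
    qed
    ultimately show ?thesis
      using t by (auto simp: zero_trees_def)
  qed
  then show "(\<lambda>(E, t). (E, maxima N t)) ` {(E, t). maxmin_tree N E t \<and> weight E t {1..N} = 0}
      \<subseteq> zero_trees {1..N}"
    by auto
qed

theorem theorem4p1:
  fixes n k :: nat
  assumes "n \<ge> 1" and "k \<le> n - 1"
  shows "\<exists>f. bij_betw f
    {p. p permutes {1..n} \<and> card (descents n p) = k}
    {(E, t). maxmin_tree (n + 1) E t \<and> weight E t {1..n+1} = 0 \<and>
             card (maxima (n + 1) t) = k + 1}"
proof -
  obtain g where g: "bij_betw g (words {1..n + 1}) (zero_trees {1..n + 1})"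
    and card_g: "\<And>xs. xs \<in> words {1..n + 1} \<Longrightarrow> card (snd (g xs)) = des xs + 1"
    using words_zero_trees_bij[of "{1..n + 1}"] by auto
  define h where "h = (\<lambda>(E :: nat set set, M). (E, restrict (tier M) {1..n + 1}))"
  define f where "f = h \<circ> (g \<circ> perm_word n)"
  let ?P = "{p. p permutes {1..n}}"
  let ?T = "{(E, t). maxmin_tree (n + 1) E t \<and> weight E t {1..n + 1} = 0}"
  have "bij_betw h (zero_trees {1..n + 1}) ?T"
    unfolding h_def by (rule bij_betw_zero_trees_maxmin) (use assms(1) in simp)
  then have f: "bij_betw f ?P ?T"
    unfolding f_def using g bij_betw_perm_word by (blast intro: bij_betw_trans)
  have card_f: "card (maxima (n + 1) (snd (f p))) = card (descents n p) + 1" if p: "p \<in> ?P" for p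
  proof -
    have w: "perm_word n p \<in> words {1..n + 1}"
      using bij_betwE[OF bij_betw_perm_word] p by blast
    obtain E M where EM: "g (perm_word n p) = (E, M)"
      by fastforce
    have "(E, M) \<in> zero_trees {1..n + 1}"
      using bij_betwE[OF g] w EM by metis
    then have "maxima (n + 1) (restrict (tier M) {1..n + 1}) = M"
      by (auto simp: zero_trees_def maxima_def tier_def)
    then show ?thesis
      using card_g[OF w] des_perm_word p EM by (simp add: f_def h_def)
  qed
  \<comment> \<open>The bijection was built for all \<open>k\<close> at once; as it matches the two
    statistics, it restricts to each of their fibres.\<close>
  have "bij_betw f {p \<in> ?P. card (descents n p) = k} {T \<in> ?T. card (maxima (n + 1) (snd T)) = k + 1}"
    by (rule bij_betw_filter[OF f]) (simp only: card_f add_right_cancel)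
  moreover have "{p \<in> ?P. card (descents n p) = k} = {p. p permutes {1..n} \<and> card (descents n p) = k}"
    "{T \<in> ?T. card (maxima (n + 1) (snd T)) = k + 1} =
     {(E, t). maxmin_tree (n + 1) E t \<and> weight E t {1..n+1} = 0 \<and> card (maxima (n + 1) t) = k + 1}"
    by auto
  ultimately show ?thesis
    by (intro exI[of _ f]) simp
qed

end
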